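(* Let $K$ be a field containing a primitive $n$-th root of unity $\alpha$, and let $F_n=(\alpha^{ij})_{0\le i,j\le n-1}$ be the Fourier $n\times n$ matrix over $K$, with rows $e_0,e_1,\ldots,e_{n-1}$. Let $$G[z]=e_0+e_1z+\cdots+e_{n-1}z^{n-1}.$$ Then the free distance of the convolutional code generated by $G[z]$ is $n^2$.
   Context: The convolutional code generated by the $1\times n$ polynomial matrix $G[z]$ is $\{u(z)G[z]:u(z)\in K[z]\}\subseteq K[z]^n$. The weight (distance) of $v(z)=\sum_i v_iz^i$ with $v_i\in K^n$ is the sum over $i$ of the numbers of non-zero entries of $v_i$; the free distance of a code is the minimum weight of a non-zero codeword. *)

theory Defs
  imports "Jordan_Normal_Form.Matrix" "HOL-Computational_Algebra.Polynomial"
begin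

definition primitive_root_of_unity :: "nat \<Rightarrow> 'a :: field \<Rightarrow> bool" where
  "primitive_root_of_unity n \<alpha> \<longleftrightarrow> n > 0 \<and> \<alpha> ^ n = 1 \<and> (\<forall>k. 0 < k \<and> k < n \<longrightarrow> \<alpha> ^ k \<noteq> 1)"

definition fourier_mat :: "nat \<Rightarrow> 'a :: field \<Rightarrow> 'a mat" where
  "fourier_mat n \<alpha> = mat n n (\<lambda>(i, j). \<alpha> ^ (i * j))"

(* An element of K[z]^n is an 'a poly vec of dimension n, and a 1 x n polynomial matrix
   is identified with its single row. *)

definition vec_coeff :: "'a :: zero poly vec \<Rightarrow> nat \<Rightarrow> 'a vec" where
  "vec_coeff v i = map_vec (\<lambda>p. coeff p i) v"

definition hamming_weight :: "'a :: zero vec \<Rightarrow> nat" where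
  "hamming_weight x = card {j. j < dim_vec x \<and> x $ j \<noteq> 0}"

definition conv_weight :: "'a :: zero poly vec \<Rightarrow> nat" where
  "conv_weight v = (\<Sum>i | vec_coeff v i \<noteq> 0\<^sub>v (dim_vec v). hamming_weight (vec_coeff v i))"

(* The index set of the sum in conv_weight is finite, so no weight collapses to the
   default value of an infinite sum. *)
lemma finite_vec_coeff_support: "finite {i. vec_coeff v i \<noteq> 0\<^sub>v (dim_vec v)}"
proof (rule finite_subset)
  show "{i. vec_coeff v i \<noteq> 0\<^sub>v (dim_vec v)} \<subseteq> (\<Union>j<dim_vec v. {..degree (v $ j)})"
  proof
    fix i assume "i \<in> {i. vec_coeff v i \<noteq> 0\<^sub>v (dim_vec v)}"
    then obtain j where "j < dim_vec v" "coeff (v $ j) i \<noteq> 0"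
      by (auto simp: vec_coeff_def vec_eq_iff)
    then show "i \<in> (\<Union>j<dim_vec v. {..degree (v $ j)})"
      by (auto intro: le_degree)
  qed
qed auto

definition conv_code :: "'a :: field poly vec \<Rightarrow> 'a poly vec set" where
  "conv_code G = {u \<cdot>\<^sub>v G | u. True}"

(* The minimum exists whenever C contains a non-zero vector; it is unspecified otherwise. *)
definition free_distance :: "'a :: field poly vec set \<Rightarrow> nat" where
  "free_distance C = (LEAST w. \<exists>v \<in> C. v \<noteq> 0\<^sub>v (dim_vec v) \<and> conv_weight v = w)"

(* e_0 + e_1 z + ... + e_(n-1) z^(n-1), where e_i is row i of the Fourier matrix with its
   entries read as constant polynomials. *)
definition fourier_generator :: "nat \<Rightarrow> 'a :: field \<Rightarrow> 'a poly vec" where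
  "fourier_generator n \<alpha> =
     finsum_vec TYPE('a poly) n
       (\<lambda>i. monom 1 i \<cdot>\<^sub>v map_vec (\<lambda>c. [:c:]) (row (fourier_mat n \<alpha>) i)) {..<n}"

end

(* Entry j of the coefficient of z^t in u(z) G[z] is p_t(alpha^j), where p_t is the polynomial
   whose coefficients are u_t, u_(t-1), ..., u_(t-n+1). Since the alpha^j are n distinct non-zero
   points, that coefficient has weight at least n - (h - l) when p_t is non-zero and its
   coefficients are supported in [l, h] (the BCH bound). If the support of u spans a .. a + d, then
   the n times t = a, ..., a + n - 1 and the min(d, n) last times of the codeword already contribute
   n^2; the generator G itself has exactly n^2 non-zero coefficients. *)
theory Submission
  imports Defs
begin

lemma primitive_root_nonzero:
  assumes "primitive_root_of_unity n \<alpha>"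
  shows "\<alpha> \<noteq> 0"
  using assms by (auto simp: primitive_root_of_unity_def power_0_left)

text \<open>A collision of exponents i < j would cancel to \<open>\<alpha> ^ (j - i) = 1\<close>
  with 0 < j - i < n.\<close>

lemma inj_on_primitive_root_powers:
  fixes \<alpha> :: "'a :: field"
  assumes "primitive_root_of_unity n \<alpha>"
  shows "inj_on (\<lambda>j. \<alpha> ^ j) {..<n}"
proof (rule linorder_inj_onI)
  fix i j assume "i < j" "i \<in> {..<n}" "j \<in> {..<n}"
  then have "\<alpha> ^ (j - i) \<noteq> 1"
    using assms by (auto simp: primitive_root_of_unity_def)
  moreover have "\<alpha> ^ j = \<alpha> ^ i * \<alpha> ^ (j - i)"
    using \<open>i < j\<close> power_add[of \<alpha> i "j - i"] by simp
  ultimately show "\<alpha> ^ i \<noteq> \<alpha> ^ j"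
    using primitive_root_nonzero[OF assms] by auto
qed auto

text \<open>Dividing p by z^l keeps every non-zero root and leaves a quotient of degree at most h -
  l. The additive form also records l \<le> h, so no truncated subtraction intervenes.\<close>

lemma card_nonzero_roots_le:
  fixes p :: "'a :: field poly"
  assumes "p \<noteq> 0" and low: "\<And>i. i < l \<Longrightarrow> coeff p i = 0"
    and high: "\<And>i. h < i \<Longrightarrow> coeff p i = 0"
  shows "card {x. x \<noteq> 0 \<and> poly p x = 0} + l \<le> h"
proof -
  obtain q where q: "p = monom 1 l * q"
    using low by (metis monom_1_dvd_iff' dvdE)
  then have "q \<noteq> 0" using \<open>p \<noteq> 0\<close> by auto
  have "card {x. x \<noteq> 0 \<and> poly p x = 0} \<le> card {x. poly q x = 0}"
    using \<open>q \<noteq> 0\<close> by (intro card_mono poly_roots_finite) (auto simp: q poly_monom)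
  also have "\<dots> \<le> degree q"
    using \<open>q \<noteq> 0\<close> by (rule card_poly_roots_bound)
  finally have "card {x. x \<noteq> 0 \<and> poly p x = 0} + l \<le> degree p"
    using \<open>q \<noteq> 0\<close> by (simp add: q degree_mult_eq degree_monom_eq)
  also have "\<dots> \<le> h" using high by (rule degree_le[OF allI[OF impI]])
  finally show ?thesis .
qed

lemma bch_bound:
  fixes p :: "'a :: field poly"
  assumes "primitive_root_of_unity n \<alpha>" and "p \<noteq> 0"
    and "\<And>i. i < l \<Longrightarrow> coeff p i = 0" and "\<And>i. h < i \<Longrightarrow> coeff p i = 0"
  shows "n - (h - l) \<le> card {j. j < n \<and> poly p (\<alpha> ^ j) \<noteq> 0}"
proof -
  let ?Z = "{j. j < n \<and> poly p (\<alpha> ^ j) = 0}" and ?N = "{j. j < n \<and> poly p (\<alpha> ^ j) \<noteq> 0}"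
  have "card ?Z = card ((\<lambda>j. \<alpha> ^ j) ` ?Z)"
    by (rule card_image[symmetric], rule inj_on_subset[OF inj_on_primitive_root_powers])
      (use assms(1) in auto)
  also have "\<dots> \<le> card {x. x \<noteq> 0 \<and> poly p x = 0}"
  proof (rule card_mono)
    show "finite {x. x \<noteq> 0 \<and> poly p x = 0}"
      by (rule finite_subset[OF _ poly_roots_finite[OF assms(2)]]) auto
  qed (use primitive_root_nonzero[OF assms(1)] in auto)
  finally have Z: "card ?Z + l \<le> h"
    using card_nonzero_roots_le[of p l h] assms(2-4) by fastforce
  have "?Z \<union> ?N = {..<n}" by auto
  then have "n = card (?Z \<union> ?N)" by simp
  also have "\<dots> = card ?Z + card ?N"
    by (rule card_Un_disjoint) auto
  finally show ?thesis using Z by linarith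
qed

text \<open>The test \<open>i \<le> t\<close> sets inputs before time 0 to zero; without it,
  truncated \<open>t - i\<close> would read \<open>coeff u 0\<close> there.\<close>

definition window_poly :: "nat \<Rightarrow> 'a :: comm_ring_1 poly \<Rightarrow> nat \<Rightarrow> 'a poly" where
  "window_poly n u t = (\<Sum>i<n. monom (if i \<le> t then coeff u (t - i) else 0) i)"

lemma coeff_window_poly:
  "coeff (window_poly n u t) i = (if i < n \<and> i \<le> t then coeff u (t - i) else 0)"
  by (auto simp: window_poly_def coeff_sum)

lemma window_poly_1: "window_poly n 1 t = (if t < n then monom 1 t else 0)"
  by (rule poly_eqI) (auto simp: coeff_window_poly)

lemma dim_fourier_generator [simp]: "dim_vec (fourier_generator n \<alpha>) = n"
proof -
  have "fourier_generator n \<alpha> \<in> carrier_vec n"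
    unfolding fourier_generator_def
    by (intro finsum_vec_closed Pi_I carrier_vecI) (simp add: fourier_mat_def)
  then show ?thesis by auto
qed

lemma index_fourier_generator:
  assumes "j < n"
  shows "fourier_generator n \<alpha> $ j = (\<Sum>i<n. monom (\<alpha> ^ (i * j)) i)"
proof -
  let ?f = "\<lambda>i. monom 1 i \<cdot>\<^sub>v map_vec (\<lambda>c. [:c:]) (row (fourier_mat n \<alpha>) i)"
  have "?f \<in> {..<n} \<rightarrow> carrier_vec n"
    by (intro Pi_I carrier_vecI) (simp add: fourier_mat_def)
  then have "fourier_generator n \<alpha> $ j = (\<Sum>i<n. ?f i $ j)"
    unfolding fourier_generator_def by (rule index_finsum_vec[OF finite_lessThan assms])
  also have "\<dots> = (\<Sum>i<n. monom (\<alpha> ^ (i * j)) i)"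
  proof (rule sum.cong[OF refl])
    fix i assume "i \<in> {..<n}"
    then have "?f i $ j = monom 1 i * [:\<alpha> ^ (i * j):]"
      using assms by (simp add: fourier_mat_def)
    also have "\<dots> = monom (\<alpha> ^ (i * j)) i"
      by (metis monom_0 mult_monom mult_1 add_0_right)
    finally show "?f i $ j = monom (\<alpha> ^ (i * j)) i" .
  qed
  finally show ?thesis .
qed

text \<open>Row i delays u by i and scales entry j by \<open>\<alpha> ^ (i * j)\<close>, which is
  the i-th power of the evaluation point \<open>\<alpha> ^ j\<close>.\<close>

lemma vec_coeff_codeword:
  assumes "j < n"
  shows "vec_coeff (u \<cdot>\<^sub>v fourier_generator n \<alpha>) t $ j = poly (window_poly n u t) (\<alpha> ^ j)"
proof -
  have "vec_coeff (u \<cdot>\<^sub>v fourier_generator n \<alpha>) t $ j = coeff (\<Sum>i<n. monom (\<alpha> ^ (i * j)) i * u) t"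
    using assms
    by (simp add: vec_coeff_def index_fourier_generator sum_distrib_left mult.commute)
  also have "\<dots> = poly (window_poly n u t) (\<alpha> ^ j)"
    unfolding window_poly_def poly_sum coeff_sum
    by (intro sum.cong) (auto simp: coeff_monom_mult poly_monom power_mult[symmetric]
        mult.commute[of j] mult.commute[of "coeff u _"])
  finally show ?thesis .
qed

lemma hamming_weight_codeword:
  "hamming_weight (vec_coeff (u \<cdot>\<^sub>v fourier_generator n \<alpha>) t) =
    card {j. j < n \<and> poly (window_poly n u t) (\<alpha> ^ j) \<noteq> 0}"
proof -
  have "dim_vec (vec_coeff (u \<cdot>\<^sub>v fourier_generator n \<alpha>) t) = n"
    by (simp add: vec_coeff_def)
  then show ?thesis
    unfolding hamming_weight_def by (metis vec_coeff_codeword)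
qed

lemma hamming_weight_zero [simp]: "hamming_weight (0\<^sub>v n) = 0"
  by (simp add: hamming_weight_def)

lemma conv_weight_eq_sum:
  assumes "finite T" and "\<And>t. t \<notin> T \<Longrightarrow> hamming_weight (vec_coeff v t) = 0"
  shows "conv_weight v = (\<Sum>t\<in>T. hamming_weight (vec_coeff v t))"
  unfolding conv_weight_def
  by (rule sum.mono_neutral_cong) (use assms finite_vec_coeff_support in auto)

lemma sum_le_conv_weight:
  assumes "finite T"
  shows "(\<Sum>t\<in>T. hamming_weight (vec_coeff v t)) \<le> conv_weight v"
proof -
  let ?S = "{i. vec_coeff v i \<noteq> 0\<^sub>v (dim_vec v)}"
  have "(\<Sum>t\<in>T. hamming_weight (vec_coeff v t)) \<le> (\<Sum>t\<in>T \<union> ?S. hamming_weight (vec_coeff v t))"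
    by (rule sum_mono2) (use assms finite_vec_coeff_support in auto)
  also have "\<dots> = conv_weight v"
    by (rule conv_weight_eq_sum[symmetric]) (use assms finite_vec_coeff_support in auto)
  finally show ?thesis .
qed

text \<open>Raising m by one costs the first sum one for each t with m < t < n, hence n - m - 1 in
  all, while the second sum gains n - m.\<close>

lemma square_le_sum_ramps:
  fixes m n :: nat
  assumes "m \<le> n"
  shows "n ^ 2 \<le> (\<Sum>t<n. n - min t m) + (\<Sum>r<m. n - r)"
  using assms
proof (induction m)
  case 0
  then show ?case by (simp add: power2_eq_square)
next
  case (Suc m)
  have "(\<Sum>t<n. n - min t m) = (\<Sum>t<n. (n - min t (Suc m)) + (if m < t then 1 else 0))"
    by (rule sum.cong) auto
  also have "\<dots> = (\<Sum>t<n. n - min t (Suc m)) + card {t \<in> {..<n}. m < t}"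
    by (simp only: sum.distrib) (simp add: sum.If_cases Int_def)
  also have "{t \<in> {..<n}. m < t} = {m<..<n}" by auto
  finally show ?case using Suc by simp
qed

lemma conv_weight_codeword_ge:
  fixes \<alpha> :: "'a :: field"
  assumes prim: "primitive_root_of_unity n \<alpha>" and "u \<noteq> 0"
  shows "n ^ 2 \<le> conv_weight (u \<cdot>\<^sub>v fourier_generator n \<alpha>)"
proof -
  define a where "a = (LEAST i. coeff u i \<noteq> 0)"
  define d where "d = degree u - a"
  \<comment> \<open>The codeword lives at the n + d times from a to a + d + n - 1. Beyond the first
    n there remain d, of which at most n are used.\<close>
  define m where "m = min d n"
  define w where "w t = hamming_weight (vec_coeff (u \<cdot>\<^sub>v fourier_generator n \<alpha>) t)" for t
  have lead: "coeff u (degree u) \<noteq> 0" using \<open>u \<noteq> 0\<close> by simp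
  have ua: "coeff u a \<noteq> 0" unfolding a_def by (rule LeastI) (rule lead)
  have low: "coeff u i = 0" if "i < a" for i using not_less_Least that unfolding a_def by blast
  have deg: "degree u = a + d" using le_degree[OF ua] by (simp add: d_def)
  have high: "coeff u i = 0" if "a + d < i" for i using that deg by (simp add: coeff_eq_0)
  have outside: "coeff u i = 0" if "i < a \<or> a + d < i" for i using that low high by blast

  have start: "n - min t m \<le> w (a + t)" if "t < n" for t
  proof -
    \<comment> \<open>Coefficient t is \<open>coeff u a\<close>. Indices above t reach inputs before
      a, and indices below t - d reach inputs after a + d, so the support lies in
      [t - d, t].\<close>
    have "coeff (window_poly n u (a + t)) t \<noteq> 0"
      using ua that by (simp add: coeff_window_poly)
    then have "window_poly n u (a + t) \<noteq> 0" by (metis coeff_0)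
    then have "n - (t - (t - d)) \<le> w (a + t)"
      unfolding w_def hamming_weight_codeword
      by (intro bch_bound[OF prim]) (auto simp: coeff_window_poly intro!: outside)
    \<comment> \<open>The truncated difference is min t d, and t < n allows d to be replaced by
      m.\<close>
    moreover have "t - (t - d) = min t m" using that by (auto simp: m_def)
    ultimately show ?thesis by simp
  qed
  have finish: "n - r \<le> w (a + d + (n - 1) - r)" if "r < m" for r
  proof -
    have r: "r < n" "r < d" using that by (auto simp: m_def)
    \<comment> \<open>Here r counts back from the last time. Coefficient n - 1 - r is the leading
      coefficient of u; smaller indices lie past its degree and the window stops at n - 1, so the
      support has width r.\<close>
    have "coeff (window_poly n u (a + d + (n - 1) - r)) (n - 1 - r) \<noteq> 0"
      using lead deg r by (simp add: coeff_window_poly)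
    then have "window_poly n u (a + d + (n - 1) - r) \<noteq> 0" by (metis coeff_0)
    then have "n - ((n - 1) - (n - 1 - r)) \<le> w (a + d + (n - 1) - r)"
      unfolding w_def hamming_weight_codeword
      by (intro bch_bound[OF prim]) (use r in \<open>auto simp: coeff_window_poly intro!: outside\<close>)
    then show ?thesis using r by simp
  qed

  let ?A = "(\<lambda>t. a + t) ` {..<n}" and ?B = "(\<lambda>r. a + d + (n - 1) - r) ` {..<m}"
  have "n ^ 2 \<le> (\<Sum>t<n. n - min t m) + (\<Sum>r<m. n - r)"
    by (rule square_le_sum_ramps) (simp add: m_def)
  also have "\<dots> \<le> (\<Sum>t<n. w (a + t)) + (\<Sum>r<m. w (a + d + (n - 1) - r))"
    by (intro add_mono sum_mono) (use start finish in auto)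
  also have "\<dots> = sum w ?A + sum w ?B"
  proof -
    have "inj_on (\<lambda>r. a + d + (n - 1) - r) {..<m}"
      by (rule inj_onI) (use m_def in auto)
    then show ?thesis by (simp add: sum.reindex)
  qed
  \<comment> \<open>The times in \<open>?A\<close> are below a + n; those in \<open>?B\<close> are
    at least a + n because r < m \<le> d.\<close>
  also have "\<dots> = sum w (?A \<union> ?B)"
    by (rule sum.union_disjoint[symmetric]) (auto simp: m_def)
  also have "\<dots> \<le> conv_weight (u \<cdot>\<^sub>v fourier_generator n \<alpha>)"
    unfolding w_def by (rule sum_le_conv_weight) simp
  finally show ?thesis .
qed

text \<open>For the input u = 1 the window at each time t < n is the monomial z^t, which vanishes at
  no \<open>\<alpha> ^ j\<close>; from time n on it is zero.\<close>

lemma conv_weight_fourier_generator: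
  fixes \<alpha> :: "'a :: field"
  assumes "primitive_root_of_unity n \<alpha>"
  shows "conv_weight (fourier_generator n \<alpha>) = n ^ 2"
proof -
  have w: "hamming_weight (vec_coeff (fourier_generator n \<alpha>) t) = (if t < n then n else 0)" for t
    using hamming_weight_codeword[of 1 n \<alpha> t] primitive_root_nonzero[OF assms]
    by (auto simp: window_poly_1 poly_monom)
  have "conv_weight (fourier_generator n \<alpha>) = (\<Sum>t<n. n)"
    by (subst conv_weight_eq_sum[of "{..<n}"]) (auto simp: w)
  then show ?thesis by (simp add: power2_eq_square)
qed

theorem proposition4p1:
  fixes \<alpha> :: "'a :: field" and n :: nat
  assumes "primitive_root_of_unity n \<alpha>"
  shows "free_distance (conv_code (fourier_generator n \<alpha>)) = n ^ 2"
  unfolding free_distance_def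
proof (rule Least_equality)
  let ?G = "fourier_generator n \<alpha>"
  have "?G \<in> conv_code ?G"
    unfolding conv_code_def by (intro CollectI exI[of _ 1]) simp
  \<comment> \<open>A zero generator would have weight 0, whereas its weight is n^2 with n >
    0.\<close>
  moreover have "?G \<noteq> 0\<^sub>v (dim_vec ?G)"
  proof
    assume "?G = 0\<^sub>v (dim_vec ?G)"
    then have "vec_coeff ?G t = 0\<^sub>v n" for t
      by (auto simp: vec_coeff_def)
    then have "conv_weight ?G = 0" by (simp add: conv_weight_def)
    then show False
      using conv_weight_fourier_generator[OF assms] assms
      by (simp add: primitive_root_of_unity_def)
  qed
  ultimately show "\<exists>v\<in>conv_code ?G. v \<noteq> 0\<^sub>v (dim_vec v) \<and> conv_weight v = n ^ 2"
    using conv_weight_fourier_generator[OF assms] by blast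
next
  fix w
  assume "\<exists>v\<in>conv_code (fourier_generator n \<alpha>). v \<noteq> 0\<^sub>v (dim_vec v) \<and> conv_weight v = w"
  then obtain u where "u \<cdot>\<^sub>v fourier_generator n \<alpha> \<noteq> 0\<^sub>v n"
    and w: "conv_weight (u \<cdot>\<^sub>v fourier_generator n \<alpha>) = w"
    by (auto simp: conv_code_def)
  then have "u \<noteq> 0" by auto
  then show "n ^ 2 \<le> w" using conv_weight_codeword_ge[OF assms] w by blast
qed

end
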